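(* Let $n>1$, $d>1$ be integers, let $P\in\mathbb{E}=\mathbb{R}[X_1,\dots,X_n]_d$, and assume that the distance $\mathrm{dist}(P,\Delta)$ between $P$ and the real discriminant is nonzero. Then each connected component of the complement of the zero level of $P$ in $\mathcal{S}^{n-1}$ contains an open spherical cap of $\mathcal{S}^{n-1}$ with radius angle $$\alpha=\frac1d\sqrt{\frac{2\,\mathrm{dist}(P,\Delta)}{\|P\|}}.$$
   Context: $\mathcal{S}^{n-1}$ is the unit sphere of $\mathbb{R}^n$. $\|P\|$ is the Bombieri norm on $\mathbb{E}$, the norm of the scalar product for which distinct monomials are orthogonal and $\|x^\alpha\|^2=\alpha!/d!$ for $|\alpha|=d$ (where $\alpha!=\prod_i\alpha_i!$). The real discriminant $\Delta\subset\mathbb{E}$ is the set of $Q\in\mathbb{E}$ for which there is $x\in\mathcal{S}^{n-1}$ with $Q(x)=0$ and $\nabla Q(x)=0$; $\mathrm{dist}$ is the distance for the Bombieri norm. The open spherical cap with center $x\in\mathcal{S}^{n-1}$ and radius angle $\alpha$ is the set of $y\in\mathcal{S}^{n-1}$ whose angle with $x$ is less than $\alpha$. *)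

theory Defs
  imports "HOL-Analysis.Analysis" "HOL-Library.Poly_Mapping"
begin

text \<open>Polynomials in variables indexed by \<open>'n\<close> are elements of the monoid algebra of the
  monomial exponents \<open>'n \<Rightarrow>\<^sub>0 nat\<close>; the number of variables is \<open>CARD('n)\<close>.\<close>

type_synonym 'n mpoly = "('n \<Rightarrow>\<^sub>0 nat) \<Rightarrow>\<^sub>0 real"

definition mdeg :: "('n::finite \<Rightarrow>\<^sub>0 nat) \<Rightarrow> nat" where
  "mdeg \<alpha> = (\<Sum>i\<in>UNIV. Poly_Mapping.lookup \<alpha> i)"

definition mfact :: "('n::finite \<Rightarrow>\<^sub>0 nat) \<Rightarrow> nat" where
  "mfact \<alpha> = (\<Prod>i\<in>UNIV. fact (Poly_Mapping.lookup \<alpha> i))"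

text \<open>Homogeneous polynomials of degree \<open>d\<close>, including \<open>0\<close>.\<close>

definition hom_polys :: "nat \<Rightarrow> 'n::finite mpoly set" where
  "hom_polys d = {P. \<forall>\<alpha>\<in>Poly_Mapping.keys P. mdeg \<alpha> = d}"

definition mpeval :: "'n::finite mpoly \<Rightarrow> real ^ 'n \<Rightarrow> real" where
  "mpeval P x = (\<Sum>\<alpha>\<in>Poly_Mapping.keys P.
      Poly_Mapping.lookup P \<alpha> * (\<Prod>i\<in>UNIV. (x $ i) ^ Poly_Mapping.lookup \<alpha> i))"

text \<open>Summing over the support of the first argument suffices, as all other terms vanish.
  This is the Bombieri scalar product only on \<open>hom_polys d\<close>.\<close>

definition bombieri_inner :: "nat \<Rightarrow> 'n::finite mpoly \<Rightarrow> 'n mpoly \<Rightarrow> real" where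
  "bombieri_inner d P Q = (\<Sum>\<alpha>\<in>Poly_Mapping.keys P.
      real (mfact \<alpha>) / fact d * Poly_Mapping.lookup P \<alpha> * Poly_Mapping.lookup Q \<alpha>)"

definition bombieri_norm :: "nat \<Rightarrow> 'n::finite mpoly \<Rightarrow> real" where
  "bombieri_norm d P = sqrt (bombieri_inner d P P)"

definition real_discriminant :: "nat \<Rightarrow> 'n::finite mpoly set" where
  "real_discriminant d =
     {Q \<in> hom_polys d. \<exists>x\<in>sphere 0 1. mpeval Q x = 0 \<and> (GDERIV (mpeval Q) x :> 0)}"

text \<open>The infimum is over a nonempty set, since \<open>0 \<in> real_discriminant d\<close>.\<close>

definition dist_discriminant :: "nat \<Rightarrow> 'n::finite mpoly \<Rightarrow> real" where
  "dist_discriminant d P = (INF Q\<in>real_discriminant d. bombieri_norm d (P - Q))"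

text \<open>For unit vectors, the angle between \<open>x\<close> and \<open>y\<close> is \<open>arccos (x \<bullet> y)\<close>.\<close>

definition open_cap :: "real ^ 'n::finite \<Rightarrow> real \<Rightarrow> (real ^ 'n) set" where
  "open_cap x a = {y \<in> sphere 0 1. arccos (x \<bullet> y) < a}"

end

theory Submission
  imports Defs
begin

text \<open>On a component \<open>C\<close>, \<open>\<bar>P\<bar>\<close> attains its maximum at a critical point \<open>x\<close> of the restriction of \<open>P\<close>
  to the sphere. There \<open>P - P(x) (x \<bullet> _) ^ d\<close> vanishes to second order, so
  \<open>dist(P, \<Delta>) \<le> \<bar>P(x)\<bar>\<close>, as \<open>(x \<bullet> _) ^ d\<close> has Bombieri norm 1.
  For \<open>y = cos t x + sin t v\<close> with \<open>v \<bottom> x\<close>, evaluation at \<open>y\<close> is the scalar product with the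
  reproducing kernel \<open>(y \<bullet> _) ^ d\<close>. Removing from it its projections on the kernels of evaluation
  at \<open>x\<close> and of differentiation at \<open>x\<close> along \<open>v\<close> leaves a remainder of squared norm
  \<open>1 - cos t ^ (2d) - d sin\<^sup>2 t cos t ^ (2d-2)\<close>, at most \<open>d(d-1)/2 sin t ^ 4\<close>. So \<open>P(y)\<close> differs from
  \<open>cos t ^ d P(x)\<close> by at most \<open>\<parallel>P\<parallel> d\<^sup>2 t\<^sup>2 / 4\<close>, which keeps \<open>P\<close> from vanishing on the cap.\<close>

section \<open>Exponents of fixed degree and the multinomial theorem\<close>

definition monoms :: "nat \<Rightarrow> ('n::finite \<Rightarrow>\<^sub>0 nat) set" where
  "monoms d = {\<alpha>. mdeg \<alpha> = d}"

definition mono_eval :: "('n::finite \<Rightarrow>\<^sub>0 nat) \<Rightarrow> real ^ 'n \<Rightarrow> real" where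
  "mono_eval \<alpha> x = (\<Prod>i\<in>UNIV. (x $ i) ^ Poly_Mapping.lookup \<alpha> i)"

text \<open>The multinomial coefficient, which is the reciprocal of the squared Bombieri norm of the
  monomial.\<close>

definition mcoeff :: "('n::finite \<Rightarrow>\<^sub>0 nat) \<Rightarrow> real" where
  "mcoeff \<alpha> = fact (mdeg \<alpha>) / real (mfact \<alpha>)"

lemma finite_monoms: "finite (monoms d :: ('n::finite \<Rightarrow>\<^sub>0 nat) set)"
proof (rule finite_subset)
  show "finite (Poly_Mapping.lookup -` (UNIV \<rightarrow>\<^sub>E {..d}) :: ('n \<Rightarrow>\<^sub>0 nat) set)"
    by (intro finite_vimageI finite_PiE) (simp_all add: inj_on_def Poly_Mapping.lookup_inject)
  show "(monoms d :: ('n \<Rightarrow>\<^sub>0 nat) set) \<subseteq> Poly_Mapping.lookup -` (UNIV \<rightarrow>\<^sub>E {..d})"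
  proof
    fix \<alpha> :: "'n \<Rightarrow>\<^sub>0 nat" assume "\<alpha> \<in> monoms d"
    then show "\<alpha> \<in> Poly_Mapping.lookup -` (UNIV \<rightarrow>\<^sub>E {..d})"
      using member_le_sum[of _ UNIV "Poly_Mapping.lookup \<alpha>"] by (simp add: monoms_def mdeg_def PiE_def)
  qed
qed

lemma mfact_pos: "mfact \<alpha> > 0"
  by (auto simp: mfact_def intro!: prod_pos)

lemma mcoeff_pos: "mcoeff \<alpha> > 0"
  by (simp add: mcoeff_def mfact_pos)

lemma mdeg_add_single: "mdeg (\<beta> + Poly_Mapping.single i 1) = Suc (mdeg \<beta>)"
  by (simp add: mdeg_def lookup_add lookup_single when_def sum.distrib)

lemma lookup_add_single_same:
  "Poly_Mapping.lookup (\<beta> + Poly_Mapping.single i 1) i = Suc (Poly_Mapping.lookup \<beta> i)"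
  by (simp add: lookup_add)

lemma mfact_add_single:
  "mfact (\<beta> + Poly_Mapping.single i 1) = Suc (Poly_Mapping.lookup \<beta> i) * mfact \<beta>"
proof -
  have "(\<Prod>j\<in>UNIV-{i}. fact (Poly_Mapping.lookup (\<beta> + Poly_Mapping.single i 1) j) :: nat)
      = (\<Prod>j\<in>UNIV-{i}. fact (Poly_Mapping.lookup \<beta> j))"
    by (intro prod.cong) (auto simp: lookup_add lookup_single when_def)
  then show ?thesis
    by (simp add: mfact_def prod.remove[of UNIV i] lookup_add algebra_simps)
qed

lemma mono_eval_add_single:
  "mono_eval (\<beta> + Poly_Mapping.single i 1) z = z $ i * mono_eval \<beta> z"
proof -
  have "(\<Prod>j\<in>UNIV-{i}. z $ j ^ Poly_Mapping.lookup (\<beta> + Poly_Mapping.single i 1) j)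
      = (\<Prod>j\<in>UNIV-{i}. z $ j ^ Poly_Mapping.lookup \<beta> j)"
    by (intro prod.cong) (auto simp: lookup_add lookup_single when_def)
  then show ?thesis
    by (simp add: mono_eval_def prod.remove[of UNIV i] lookup_add)
qed

text \<open>Reindexing behind differentiation in the variable \<open>i\<close>: truncated
  subtraction inverts the increment exactly where the exponent of \<open>i\<close> is
  positive.\<close>

lemma bij_betw_add_single:
  "bij_betw (\<lambda>\<beta>. \<beta> + Poly_Mapping.single i 1) (monoms d)
     {\<alpha> \<in> monoms (Suc d). Poly_Mapping.lookup \<alpha> i > 0}"
proof (rule bij_betw_byWitness[where f' = "\<lambda>\<alpha>. \<alpha> - Poly_Mapping.single i 1"])
  have *: "\<alpha> - Poly_Mapping.single i 1 + Poly_Mapping.single i 1 = \<alpha>"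
    if "Poly_Mapping.lookup \<alpha> i > 0" for \<alpha> :: "'a \<Rightarrow>\<^sub>0 nat"
    using that by (intro poly_mapping_eqI)
      (auto simp: lookup_add lookup_minus lookup_single when_def)
  then show "\<forall>\<alpha>\<in>{\<alpha> \<in> monoms (Suc d). Poly_Mapping.lookup \<alpha> i > 0}.
    \<alpha> - Poly_Mapping.single i 1 + Poly_Mapping.single i 1 = \<alpha>"
    by blast
  show "(\<lambda>\<alpha>. \<alpha> - Poly_Mapping.single i 1) ` {\<alpha> \<in> monoms (Suc d). Poly_Mapping.lookup \<alpha> i > 0}
    \<subseteq> monoms d"
  proof safe
    fix \<alpha> assume "\<alpha> \<in> monoms (Suc d)" "Poly_Mapping.lookup \<alpha> i > 0"
    then show "\<alpha> - Poly_Mapping.single i 1 \<in> monoms d"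
      using mdeg_add_single[of "\<alpha> - Poly_Mapping.single i 1" i] *[of \<alpha>]
      by (simp add: monoms_def)
  qed
qed (auto simp: monoms_def mdeg_add_single lookup_add simp del: One_nat_def)

lemma multinomial_theorem:
  "(\<Sum>\<alpha>\<in>monoms d. mcoeff \<alpha> * mono_eval \<alpha> z) = (\<Sum>i\<in>UNIV. z $ i) ^ d"
\<comment> \<open>Apply the Euler operator \<open>\<Sum>i. z\<^sub>i \<partial>/\<partial>z\<^sub>i\<close> to \<open>\<Sum>\<alpha>. z\<^sup>\<alpha> / \<alpha>!\<close> over degree \<open>d + 1\<close>.\<close>
proof (induction d)
  case 0
  have "monoms 0 = {0 :: 'a \<Rightarrow>\<^sub>0 nat}"
    by (auto simp: monoms_def mdeg_def intro!: poly_mapping_eqI)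
  then show ?case
    by (simp add: mcoeff_def mono_eval_def mdeg_def mfact_def)
next
  case (Suc d)
  \<comment> \<open>The exponent brought down by differentiation cancels against the factorial and
    lowers the degree by one. Terms with exponent 0 drop out.\<close>
  have deriv: "(\<Sum>\<alpha>\<in>monoms (Suc d). real (Poly_Mapping.lookup \<alpha> i) * (mono_eval \<alpha> z / real (mfact \<alpha>)))
      = z $ i * (\<Sum>\<beta>\<in>monoms d. mono_eval \<beta> z / real (mfact \<beta>))" for i
  proof -
    have "(\<Sum>\<alpha>\<in>monoms (Suc d). real (Poly_Mapping.lookup \<alpha> i) * (mono_eval \<alpha> z / real (mfact \<alpha>)))
        = (\<Sum>\<alpha>\<in>{\<alpha>\<in>monoms (Suc d). Poly_Mapping.lookup \<alpha> i > 0}.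
            real (Poly_Mapping.lookup \<alpha> i) * (mono_eval \<alpha> z / real (mfact \<alpha>)))"
      by (intro sum.mono_neutral_right) (auto simp: finite_monoms)
    also have "\<dots> = (\<Sum>\<beta>\<in>monoms d. z $ i * (mono_eval \<beta> z / real (mfact \<beta>)))"
      by (subst sum.reindex_bij_betw[OF bij_betw_add_single, symmetric])
        (auto intro!: sum.cong simp: mfact_add_single mono_eval_add_single lookup_add_single_same
          simp del: One_nat_def of_nat_Suc mult_Suc)
    finally show ?thesis by (simp add: sum_distrib_left)
  qed
  \<comment> \<open>Summed over \<open>i\<close>, the exponents brought down add up to the degree
    \<open>Suc d\<close>.\<close>
  have "real (Suc d) * (\<Sum>\<alpha>\<in>monoms (Suc d). mono_eval \<alpha> z / real (mfact \<alpha>))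
      = (\<Sum>\<alpha>\<in>monoms (Suc d). \<Sum>i\<in>UNIV.
          real (Poly_Mapping.lookup \<alpha> i) * (mono_eval \<alpha> z / real (mfact \<alpha>)))"
    unfolding sum_distrib_left
  proof (intro sum.cong refl)
    fix \<alpha> :: "'a \<Rightarrow>\<^sub>0 nat" assume "\<alpha> \<in> monoms (Suc d)"
    then have "real (Suc d) = (\<Sum>i\<in>UNIV. real (Poly_Mapping.lookup \<alpha> i))"
      by (simp add: monoms_def mdeg_def del: of_nat_Suc flip: of_nat_sum)
    then show "real (Suc d) * (mono_eval \<alpha> z / real (mfact \<alpha>)) =
      (\<Sum>i\<in>UNIV. real (Poly_Mapping.lookup \<alpha> i) * (mono_eval \<alpha> z / real (mfact \<alpha>)))"
      by (simp only: sum_distrib_right)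
  qed
  also have "\<dots> = (\<Sum>i\<in>UNIV. z $ i * (\<Sum>\<beta>\<in>monoms d. mono_eval \<beta> z / real (mfact \<beta>)))"
    by (subst sum.swap) (simp only: deriv)
  finally have step: "real (Suc d) * (\<Sum>\<alpha>\<in>monoms (Suc d). mono_eval \<alpha> z / real (mfact \<alpha>))
      = (\<Sum>i\<in>UNIV. z $ i) * (\<Sum>\<beta>\<in>monoms d. mono_eval \<beta> z / real (mfact \<beta>))"
    by (simp only: sum_distrib_right)
  have pull: "(\<Sum>\<alpha>\<in>monoms k. mcoeff \<alpha> * mono_eval \<alpha> z)
      = fact k * (\<Sum>\<alpha>\<in>monoms k. mono_eval \<alpha> z / real (mfact \<alpha>))" for k
    unfolding sum_distrib_left
    by (intro sum.cong) (auto simp: monoms_def mcoeff_def)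
  have "(\<Sum>\<alpha>\<in>monoms (Suc d). mcoeff \<alpha> * mono_eval \<alpha> z)
      = fact d * (real (Suc d) * (\<Sum>\<alpha>\<in>monoms (Suc d). mono_eval \<alpha> z / real (mfact \<alpha>)))"
    by (simp only: pull fact_Suc of_nat_mult mult_ac)
  also have "\<dots> = (\<Sum>i\<in>UNIV. z $ i) * (\<Sum>\<beta>\<in>monoms d. mcoeff \<beta> * mono_eval \<beta> z)"
    by (simp only: step pull mult_ac)
  finally show ?case by (simp add: Suc.IH)
qed

section \<open>The reproducing kernel of evaluation and its derivatives\<close>

text \<open>The multinomial theorem at the componentwise product of \<open>u\<close> and
  \<open>x\<close>. The sum is the Bombieri scalar product of the kernels of evaluation at
  \<open>u\<close> and at \<open>x\<close>.\<close>

lemma kernel_eq_inner_power: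
  "(\<Sum>\<alpha>\<in>monoms d. mcoeff \<alpha> * mono_eval \<alpha> u * mono_eval \<alpha> x) = (u \<bullet> x) ^ d"
proof -
  have "mono_eval \<alpha> u * mono_eval \<alpha> x = mono_eval \<alpha> (\<chi> i. u $ i * x $ i)" for \<alpha> :: "'a \<Rightarrow>\<^sub>0 nat"
    by (simp add: mono_eval_def power_mult_distrib prod.distrib)
  then show ?thesis
    using multinomial_theorem[where d = d and z = "\<chi> i. u $ i * x $ i"]
    by (simp add: inner_vec_def mult.assoc)
qed

text \<open>No explicit formula is given: the sums it enters are evaluated by differentiating the
  kernel identity.\<close>

definition mono_deriv :: "('n::finite \<Rightarrow>\<^sub>0 nat) \<Rightarrow> real ^ 'n \<Rightarrow> real ^ 'n \<Rightarrow> real" where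
  "mono_deriv \<alpha> x = frechet_derivative (mono_eval \<alpha>) (at x)"

lemma has_derivative_mono_eval: "(mono_eval \<alpha> has_derivative mono_deriv \<alpha> x) (at x)"
proof -
  have "mono_eval \<alpha> differentiable (at x)"
    unfolding mono_eval_def differentiable_def
    by (rule exI, rule has_derivative_prod, rule has_derivative_power,
        rule bounded_linear.has_derivative[OF bounded_linear_vec_nth], rule has_derivative_ident)
  then show ?thesis
    by (simp add: mono_deriv_def frechet_derivative_works)
qed

lemma has_derivative_inner_power:
  fixes u x :: "'a::real_inner"
  shows "((\<lambda>x. (u \<bullet> x) ^ d) has_derivative (\<lambda>v. real d * (u \<bullet> x) ^ (d - 1) * (u \<bullet> v))) (at x)"
  by (rule has_derivative_eq_rhs, rule has_derivative_power,
      rule has_derivative_inner_right, rule has_derivative_ident) (auto simp: fun_eq_iff)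

text \<open>Both sides are derivatives in \<open>x\<close> along \<open>v\<close> of the two sides
  of \<open>kernel_eq_inner_power\<close>, hence equal by uniqueness.\<close>

lemma kernel_deriv:
  "(\<Sum>\<alpha>\<in>monoms d. mcoeff \<alpha> * mono_eval \<alpha> u * mono_deriv \<alpha> x v)
     = real d * (u \<bullet> x) ^ (d - 1) * (u \<bullet> v)"
proof -
  have "((\<lambda>x. \<Sum>\<alpha>\<in>monoms d. mcoeff \<alpha> * mono_eval \<alpha> u * mono_eval \<alpha> x) has_derivative
      (\<lambda>v. \<Sum>\<alpha>\<in>monoms d. mcoeff \<alpha> * mono_eval \<alpha> u * mono_deriv \<alpha> x v)) (at x)"
    by (intro has_derivative_sum has_derivative_mult_right has_derivative_mono_eval)
  then have "((\<lambda>x. (u \<bullet> x) ^ d) has_derivative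
      (\<lambda>v. \<Sum>\<alpha>\<in>monoms d. mcoeff \<alpha> * mono_eval \<alpha> u * mono_deriv \<alpha> x v)) (at x)"
    by (simp only: kernel_eq_inner_power)
  from has_derivative_unique[OF this has_derivative_inner_power] show ?thesis
    by (rule fun_cong)
qed

text \<open>Differentiates \<open>kernel_deriv\<close> in \<open>u\<close> at \<open>u = x\<close>
  along \<open>v\<close>; the second term of the product rule carries the factor
  \<open>x \<bullet> v = 0\<close>. The sum is the squared norm of the kernel of differentiation at
  \<open>x\<close> along \<open>v\<close>.\<close>

lemma kernel_deriv_deriv:
  assumes "norm x = 1" "x \<bullet> v = 0"
  shows "(\<Sum>\<alpha>\<in>monoms d. mcoeff \<alpha> * mono_deriv \<alpha> x v * mono_deriv \<alpha> x v) = real d * (v \<bullet> v)"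
proof -
  have xx: "x \<bullet> x = 1"
    using assms(1) by (simp add: norm_eq_1)
  have "((\<lambda>u. \<Sum>\<alpha>\<in>monoms d. mcoeff \<alpha> * mono_eval \<alpha> u * mono_deriv \<alpha> x v) has_derivative
      (\<lambda>h. \<Sum>\<alpha>\<in>monoms d. mcoeff \<alpha> * mono_deriv \<alpha> x h * mono_deriv \<alpha> x v)) (at x)"
    by (intro has_derivative_sum has_derivative_mult_right has_derivative_mult_left
        has_derivative_mono_eval)
  then have 1: "((\<lambda>u. real d * (x \<bullet> u) ^ (d - 1) * (u \<bullet> v)) has_derivative
      (\<lambda>h. \<Sum>\<alpha>\<in>monoms d. mcoeff \<alpha> * mono_deriv \<alpha> x h * mono_deriv \<alpha> x v)) (at x)"
    by (simp only: kernel_deriv inner_commute[of x])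
  have 2: "((\<lambda>u. real d * (x \<bullet> u) ^ (d - 1) * (u \<bullet> v)) has_derivative
      (\<lambda>h. real d * (x \<bullet> x) ^ (d - 1) * (h \<bullet> v)
         + real d * (real (d - 1) * (x \<bullet> x) ^ (d - 1 - 1) * (x \<bullet> h)) * (x \<bullet> v))) (at x)"
    by (intro has_derivative_mult has_derivative_mult_right has_derivative_inner_power
        has_derivative_inner_left has_derivative_ident)
  from fun_cong[OF has_derivative_unique[OF 1 2], of v] show ?thesis
    by (simp add: xx assms(2))
qed

section \<open>Homogeneous polynomials and the Bombieri norm\<close>

definition mpderiv :: "'n::finite mpoly \<Rightarrow> real ^ 'n \<Rightarrow> real ^ 'n \<Rightarrow> real" where
  "mpderiv P x v = (\<Sum>\<alpha>\<in>Poly_Mapping.keys P. Poly_Mapping.lookup P \<alpha> * mono_deriv \<alpha> x v)"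

lemma has_derivative_mpeval: "(mpeval P has_derivative mpderiv P x) (at x)"
  unfolding mpderiv_def mpeval_def mono_eval_def[symmetric]
  by (intro has_derivative_sum has_derivative_mult_right has_derivative_mono_eval)

lemma continuous_on_mpeval: "continuous_on S (mpeval P)"
  by (intro continuous_at_imp_continuous_on ballI has_derivative_continuous[OF has_derivative_mpeval])

lemma hom_polys_keys: "P \<in> hom_polys d \<longleftrightarrow> Poly_Mapping.keys P \<subseteq> monoms d"
  by (auto simp: hom_polys_def monoms_def)

text \<open>Trades the support, which varies with the polynomial, for an index set common to degree
  \<open>d\<close>.\<close>

lemma sum_keys_eq_sum_monoms:
  assumes "P \<in> hom_polys d" "\<And>\<alpha>. Poly_Mapping.lookup P \<alpha> = 0 \<Longrightarrow> f \<alpha> = 0"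
  shows "sum f (Poly_Mapping.keys P) = sum f (monoms d)"
  using assms by (intro sum.mono_neutral_left)
    (auto simp: hom_polys_keys finite_monoms in_keys_iff)

lemma mpeval_hom:
  "P \<in> hom_polys d \<Longrightarrow> mpeval P x = (\<Sum>\<alpha>\<in>monoms d. Poly_Mapping.lookup P \<alpha> * mono_eval \<alpha> x)"
  unfolding mpeval_def mono_eval_def[symmetric] by (rule sum_keys_eq_sum_monoms) auto

lemma mpderiv_hom:
  "P \<in> hom_polys d \<Longrightarrow> mpderiv P x v = (\<Sum>\<alpha>\<in>monoms d. Poly_Mapping.lookup P \<alpha> * mono_deriv \<alpha> x v)"
  unfolding mpderiv_def by (rule sum_keys_eq_sum_monoms) auto

lemma bombieri_inner_hom:
  assumes "P \<in> hom_polys d"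
  shows "bombieri_inner d P P = (\<Sum>\<alpha>\<in>monoms d. (Poly_Mapping.lookup P \<alpha>)\<^sup>2 / mcoeff \<alpha>)"
proof -
  have "bombieri_inner d P P = (\<Sum>\<alpha>\<in>monoms d.
      real (mfact \<alpha>) / fact d * Poly_Mapping.lookup P \<alpha> * Poly_Mapping.lookup P \<alpha>)"
    unfolding bombieri_inner_def by (rule sum_keys_eq_sum_monoms[OF assms]) auto
  also have "\<dots> = (\<Sum>\<alpha>\<in>monoms d. (Poly_Mapping.lookup P \<alpha>)\<^sup>2 / mcoeff \<alpha>)"
    by (intro sum.cong) (auto simp: monoms_def mcoeff_def power2_eq_square)
  finally show ?thesis .
qed

lemma bombieri_norm_nonneg: "bombieri_norm d P \<ge> 0"
  by (auto simp: bombieri_norm_def bombieri_inner_def mult.assoc intro!: sum_nonneg)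

text \<open>Cauchy-Schwarz after splitting each term by \<open>sqrt (mcoeff \<alpha>)\<close>. Here
  \<open>r\<close> lists the values of a linear functional on the monomials, and the last square
  root is the norm of its representing polynomial.\<close>

lemma bombieri_Cauchy_Schwarz:
  assumes "P \<in> hom_polys d"
  shows "\<bar>\<Sum>\<alpha>\<in>monoms d. Poly_Mapping.lookup P \<alpha> * r \<alpha>\<bar>
    \<le> bombieri_norm d P * sqrt (\<Sum>\<alpha>\<in>monoms d. mcoeff \<alpha> * (r \<alpha>)\<^sup>2)"
proof (rule power2_le_imp_le)
  let ?a = "\<lambda>\<alpha>. Poly_Mapping.lookup P \<alpha> / sqrt (mcoeff \<alpha>)"
  let ?b = "\<lambda>\<alpha>. sqrt (mcoeff \<alpha>) * r \<alpha>"
  have pos: "mcoeff \<alpha> \<ge> 0" "mcoeff \<alpha> \<noteq> 0" for \<alpha> :: "'a \<Rightarrow>\<^sub>0 nat"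
    using mcoeff_pos[of \<alpha>] by auto
  have "\<bar>\<Sum>\<alpha>\<in>monoms d. Poly_Mapping.lookup P \<alpha> * r \<alpha>\<bar>\<^sup>2 = (\<Sum>\<alpha>\<in>monoms d. ?a \<alpha> * ?b \<alpha>)\<^sup>2"
    by (simp add: pos)
  also have "\<dots> \<le> (\<Sum>\<alpha>\<in>monoms d. (?a \<alpha>)\<^sup>2) * (\<Sum>\<alpha>\<in>monoms d. (?b \<alpha>)\<^sup>2)"
    by (rule Cauchy_Schwarz_ineq_sum)
  also have "\<dots> = bombieri_inner d P P * (\<Sum>\<alpha>\<in>monoms d. mcoeff \<alpha> * (r \<alpha>)\<^sup>2)"
    by (simp add: bombieri_inner_hom[OF assms] power_divide power_mult_distrib pos)
  also have "\<dots> = (bombieri_norm d P * sqrt (\<Sum>\<alpha>\<in>monoms d. mcoeff \<alpha> * (r \<alpha>)\<^sup>2))\<^sup>2"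
    by (simp add: bombieri_norm_def power_mult_distrib bombieri_inner_hom[OF assms] sum_nonneg pos)
  finally show "\<bar>\<Sum>\<alpha>\<in>monoms d. Poly_Mapping.lookup P \<alpha> * r \<alpha>\<bar>\<^sup>2
    \<le> (bombieri_norm d P * sqrt (\<Sum>\<alpha>\<in>monoms d. mcoeff \<alpha> * (r \<alpha>)\<^sup>2))\<^sup>2" .
  show "0 \<le> bombieri_norm d P * sqrt (\<Sum>\<alpha>\<in>monoms d. mcoeff \<alpha> * (r \<alpha>)\<^sup>2)"
    by (simp add: bombieri_norm_nonneg sum_nonneg pos)
qed

section \<open>Powers of linear forms and homogeneity\<close>

text \<open>The polynomial \<open>k * (x \<bullet> _) ^ d\<close>, built from its coefficients so
  that its norm can be read off.\<close>

definition linear_power :: "nat \<Rightarrow> real ^ 'n::finite \<Rightarrow> real \<Rightarrow> 'n mpoly" where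
  "linear_power d x k = (\<Sum>\<alpha>\<in>monoms d. Poly_Mapping.single \<alpha> (k * mcoeff \<alpha> * mono_eval \<alpha> x))"

lemma lookup_linear_power:
  "Poly_Mapping.lookup (linear_power d x k) \<alpha>
     = (if \<alpha> \<in> monoms d then k * mcoeff \<alpha> * mono_eval \<alpha> x else 0)"
  by (simp add: linear_power_def lookup_sum lookup_single when_def finite_monoms)

lemma linear_power_hom: "linear_power d x k \<in> hom_polys d"
  by (auto simp: hom_polys_keys in_keys_iff lookup_linear_power split: if_splits)

lemma mpeval_linear_power: "mpeval (linear_power d x k) z = k * (x \<bullet> z) ^ d"
  by (simp add: mpeval_hom[OF linear_power_hom] lookup_linear_power
      kernel_eq_inner_power[symmetric] sum_distrib_left mult.assoc)

text \<open>The squared norm is \<open>k\<^sup>2\<close> times the kernel on the diagonal, which is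
  1 at a unit vector.\<close>

lemma bombieri_norm_linear_power:
  assumes "norm x = 1"
  shows "bombieri_norm d (linear_power d x k) = \<bar>k\<bar>"
proof -
  have "bombieri_inner d (linear_power d x k) (linear_power d x k)
      = (\<Sum>\<alpha>\<in>monoms d. k\<^sup>2 * (mcoeff \<alpha> * mono_eval \<alpha> x * mono_eval \<alpha> x))"
    unfolding bombieri_inner_hom[OF linear_power_hom]
    by (intro sum.cong) (auto simp: lookup_linear_power power2_eq_square order_less_imp_not_eq2[OF mcoeff_pos])
  also have "\<dots> = k\<^sup>2 * (x \<bullet> x) ^ d"
    by (simp only: sum_distrib_left[symmetric] kernel_eq_inner_power)
  finally show ?thesis
    using assms by (simp add: bombieri_norm_def norm_eq_1)
qed

lemma hom_polys_diff:
  assumes "P \<in> hom_polys d" "Q \<in> hom_polys d"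
  shows "P - Q \<in> hom_polys d"
  using assms keys_diff[of P Q] by (auto simp: hom_polys_keys)

lemma mpeval_diff:
  assumes "P \<in> hom_polys d" "Q \<in> hom_polys d"
  shows "mpeval (P - Q) x = mpeval P x - mpeval Q x"
  by (simp add: mpeval_hom[OF assms(1)] mpeval_hom[OF assms(2)] mpeval_hom[OF hom_polys_diff[OF assms]]
      lookup_minus left_diff_distrib sum_subtractf)

lemma mpeval_scaleR:
  assumes "P \<in> hom_polys d"
  shows "mpeval P (t *\<^sub>R x) = t ^ d * mpeval P x"
proof -
  have "mono_eval \<alpha> (t *\<^sub>R x) = t ^ d * mono_eval \<alpha> x" if "\<alpha> \<in> monoms d" for \<alpha>
    using that by (auto simp: mono_eval_def power_mult_distrib prod.distrib monoms_def mdeg_def power_sum)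
  then show ?thesis
    by (simp add: mpeval_hom[OF assms] sum_distrib_left mult_ac)
qed

text \<open>Differentiates \<open>mpeval P (t *\<^sub>R x) = t ^ d * mpeval P x\<close> at
  \<open>t = 1\<close>.\<close>

lemma mpderiv_Euler:
  assumes "P \<in> hom_polys d"
  shows "mpderiv P x x = real d * mpeval P x"
proof -
  have "((\<lambda>t. t *\<^sub>R x) has_derivative (\<lambda>t. t *\<^sub>R x)) (at (1::real))"
    by (intro has_derivative_scaleR_left has_derivative_ident)
  from has_derivative_compose[OF this has_derivative_mpeval[of P "1 *\<^sub>R x"]]
  have "((\<lambda>t. t ^ d * mpeval P x) has_derivative (\<lambda>t. mpderiv P x (t *\<^sub>R x))) (at (1::real))"
    by (simp add: mpeval_scaleR[OF assms])
  moreover have "((\<lambda>t. t ^ d * mpeval P x) has_derivative (\<lambda>t. t * real d * mpeval P x)) (at (1::real))"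
    by (rule has_derivative_eq_rhs, (rule derivative_intros)+) (simp add: fun_eq_iff)
  ultimately have "(\<lambda>t. mpderiv P x (t *\<^sub>R x)) = (\<lambda>t. t * real d * mpeval P x)"
    by (rule has_derivative_unique)
  from fun_cong[OF this, of 1] show ?thesis by simp
qed

section \<open>Distance to the real discriminant\<close>

lemma dist_discriminant_le:
  assumes "Q \<in> real_discriminant d"
  shows "dist_discriminant d P \<le> bombieri_norm d (P - Q)"
  unfolding dist_discriminant_def using assms
  by (intro cINF_lower bdd_belowI2[of _ 0] bombieri_norm_nonneg)

text \<open>Any unit vector is a singular zero. Besides nonemptiness, this yields the bound of the
  distance by the norm of \<open>P\<close>.\<close>

lemma zero_in_real_discriminant: "(0 :: 'n::finite mpoly) \<in> real_discriminant d"
proof -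
  have "\<exists>x :: real ^ 'n. norm x = 1"
    by (rule exI[of _ "axis undefined 1"]) simp
  then show ?thesis
    unfolding real_discriminant_def hom_polys_def mpeval_def gderiv_def by auto
qed

lemma dist_discriminant_nonneg: "dist_discriminant d (P :: 'n::finite mpoly) \<ge> 0"
  unfolding dist_discriminant_def
  by (rule cINF_greatest) (use zero_in_real_discriminant bombieri_norm_nonneg in blast)+

lemma dist_discriminant_le_critical_value:
  assumes P: "P \<in> hom_polys d" and x: "norm x = 1"
    and crit: "\<And>v. norm v = 1 \<Longrightarrow> x \<bullet> v = 0 \<Longrightarrow> mpderiv P x v = 0"
  shows "dist_discriminant d P \<le> \<bar>mpeval P x\<bar>"
proof -
  define L where "L = linear_power d x (mpeval P x)"
  have L: "L \<in> hom_polys d"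
    by (simp add: L_def linear_power_hom)
  have xx: "x \<bullet> x = 1"
    using x by (simp add: norm_eq_1)
  have lin: "linear (mpderiv P x)"
    using has_derivative_mpeval has_derivative_linear by blast
  have orth: "mpderiv P x v = 0" if "x \<bullet> v = 0" for v
  proof (cases "v = 0")
    case True
    then show ?thesis using linear_0[OF lin] by simp
  next
    case False
    have "mpderiv P x (v /\<^sub>R norm v) = 0"
      using that False by (intro crit) auto
    then show ?thesis
      using False by (simp add: linear_cmul[OF lin])
  qed
  \<comment> \<open>Split \<open>h\<close> into its radial and tangential parts: Euler's identity
    determines the first, \<open>orth\<close> kills the second. The result is the derivative of
    \<open>L\<close> at \<open>x\<close>.\<close>
  have grad: "mpderiv P x h = mpeval P x * (real d * (x \<bullet> h))" for h
  proof -
    have "mpderiv P x h = mpderiv P x ((x \<bullet> h) *\<^sub>R x + (h - (x \<bullet> h) *\<^sub>R x))"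
      by simp
    also have "\<dots> = (x \<bullet> h) * mpderiv P x x + mpderiv P x (h - (x \<bullet> h) *\<^sub>R x)"
      by (simp only: linear_add[OF lin] linear_cmul[OF lin] real_scaleR_def)
    also have "mpderiv P x (h - (x \<bullet> h) *\<^sub>R x) = 0"
      by (rule orth) (simp add: inner_diff_right xx)
    finally show ?thesis
      by (simp add: mpderiv_Euler[OF P])
  qed
  have ev: "mpeval (P - L) = (\<lambda>z. mpeval P z - mpeval P x * (x \<bullet> z) ^ d)"
    by (simp add: fun_eq_iff mpeval_diff[OF P L]) (simp add: L_def mpeval_linear_power)
  have "(mpeval (P - L) has_derivative
      (\<lambda>h. mpderiv P x h - mpeval P x * (real d * (x \<bullet> x) ^ (d - 1) * (x \<bullet> h)))) (at x)"
    unfolding ev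
    by (intro has_derivative_diff has_derivative_mult_right has_derivative_inner_power
        has_derivative_mpeval)
  then have "GDERIV (mpeval (P - L)) x :> 0"
    by (simp add: gderiv_def grad xx)
  moreover have "mpeval (P - L) x = 0"
    by (simp add: ev xx)
  ultimately have "P - L \<in> real_discriminant d"
    using x hom_polys_diff[OF P L] by (auto simp: real_discriminant_def)
  from dist_discriminant_le[OF this, of P] show ?thesis
    by (simp add: L_def bombieri_norm_linear_power[OF x])
qed

section \<open>Estimates near a critical point\<close>

text \<open>The left side is the probability of at least two failures in \<open>Suc k\<close>
  independent trials with success probability \<open>p\<close>; the right side is the union bound
  over pairs of trials.\<close>

lemma binomial_tail_le:
  fixes p :: real
  assumes "0 \<le> p" "p \<le> 1"
  shows "1 - p ^ Suc k - real (Suc k) * p ^ k * (1 - p) \<le> real (Suc k) * real k / 2 * (1 - p)\<^sup>2"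
proof (induction k)
  case 0
  then show ?case by simp
next
  case (Suc k)
  \<comment> \<open>The added term is the chance that the second failure falls exactly on the new
    trial.\<close>
  have "1 - p ^ Suc (Suc k) - real (Suc (Suc k)) * p ^ Suc k * (1 - p)
      = (1 - p ^ Suc k - real (Suc k) * p ^ k * (1 - p)) + real (Suc k) * (p ^ k * (1 - p)\<^sup>2)"
    by (simp add: algebra_simps power2_eq_square)
  also have "\<dots> \<le> real (Suc k) * real k / 2 * (1 - p)\<^sup>2 + real (Suc k) * (1 * (1 - p)\<^sup>2)"
    using assms by (intro add_mono Suc.IH mult_left_mono mult_right_mono power_le_one) auto
  also have "\<dots> = real (Suc (Suc k)) * real (Suc k) / 2 * (1 - p)\<^sup>2"
    by (simp add: field_simps)
  finally show ?case .
qed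

lemma mpeval_near_critical_point:
  assumes P: "P \<in> hom_polys d" and d: "d > 0" and x: "norm x = 1" and v: "norm v = 1"
    and orth: "x \<bullet> v = 0" and crit: "mpderiv P x v = 0"
  shows "\<bar>mpeval P (cos t *\<^sub>R x + sin t *\<^sub>R v) - cos t ^ d * mpeval P x\<bar>
    \<le> bombieri_norm d P * sqrt (real d * (real d - 1) / 2) * (sin t)\<^sup>2"
proof -
  define c s where "c = cos t" and "s = sin t"
  define y where "y = c *\<^sub>R x + s *\<^sub>R v"
  \<comment> \<open>Values on monomials of the remainder functional. The kernels of evaluation and
    of differentiation are orthogonal, with squared norms 1 and \<open>d\<close>, so the projection
    coefficients are \<open>c ^ d\<close> and \<open>(d * c ^ (d - 1) * s) / d\<close>.\<close>
  define r where "r \<alpha> = mono_eval \<alpha> y - c ^ d * mono_eval \<alpha> x - c ^ (d - 1) * s * mono_deriv \<alpha> x v" for \<alpha>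
  obtain k where k: "d = Suc k"
    using d by (cases d) auto
  have cs: "s\<^sup>2 = 1 - c\<^sup>2"
    by (simp add: c_def s_def sin_squared_eq)
  have inner: "x \<bullet> x = 1" "v \<bullet> v = 1" "x \<bullet> v = 0" "v \<bullet> x = 0"
    using x v orth by (auto simp: norm_eq_1 inner_commute)
  have y: "y \<bullet> y = 1" "y \<bullet> x = c" "y \<bullet> v = s"
    using cs by (auto simp: y_def inner inner_add_left inner_add_right power2_eq_square)
  \<comment> \<open>Expanding the square leaves only pairings that the kernel lemmas evaluate; the
    last one vanishes because \<open>x \<bullet> v = 0\<close>.\<close>
  have "(\<Sum>\<alpha>\<in>monoms d. mcoeff \<alpha> * (r \<alpha>)\<^sup>2) =
      (\<Sum>\<alpha>\<in>monoms d. mcoeff \<alpha> * mono_eval \<alpha> y * mono_eval \<alpha> y)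
      + (c ^ d)\<^sup>2 * (\<Sum>\<alpha>\<in>monoms d. mcoeff \<alpha> * mono_eval \<alpha> x * mono_eval \<alpha> x)
      + (c ^ (d - 1) * s)\<^sup>2 * (\<Sum>\<alpha>\<in>monoms d. mcoeff \<alpha> * mono_deriv \<alpha> x v * mono_deriv \<alpha> x v)
      - 2 * c ^ d * (\<Sum>\<alpha>\<in>monoms d. mcoeff \<alpha> * mono_eval \<alpha> y * mono_eval \<alpha> x)
      - 2 * (c ^ (d - 1) * s) * (\<Sum>\<alpha>\<in>monoms d. mcoeff \<alpha> * mono_eval \<alpha> y * mono_deriv \<alpha> x v)
      + 2 * c ^ d * (c ^ (d - 1) * s) * (\<Sum>\<alpha>\<in>monoms d. mcoeff \<alpha> * mono_eval \<alpha> x * mono_deriv \<alpha> x v)"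
    unfolding sum_distrib_left sum_subtractf[symmetric] sum.distrib[symmetric]
    by (intro sum.cong) (auto simp: r_def power2_eq_square algebra_simps)
  also have "\<dots> = 1 + (c ^ d)\<^sup>2 + (c ^ (d - 1) * s)\<^sup>2 * real d - 2 * c ^ d * c ^ d
      - 2 * (c ^ (d - 1) * s) * (real d * c ^ (d - 1) * s)"
    by (simp add: kernel_eq_inner_power kernel_deriv kernel_deriv_deriv[OF x orth] inner y)
  also have "\<dots> = 1 - (c ^ d)\<^sup>2 - real d * (c ^ k)\<^sup>2 * s\<^sup>2"
    by (simp add: k power2_eq_square algebra_simps)
  also have "\<dots> = 1 - (c\<^sup>2) ^ Suc k - real (Suc k) * (c\<^sup>2) ^ k * (1 - c\<^sup>2)"
    by (simp only: k cs power_mult[symmetric] mult.commute)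
  also have "\<dots> \<le> real (Suc k) * real k / 2 * (1 - c\<^sup>2)\<^sup>2"
    by (rule binomial_tail_le) (auto simp: c_def abs_square_le_1)
  also have "\<dots> = real d * (real d - 1) / 2 * (s\<^sup>2)\<^sup>2"
    by (simp add: k cs)
  finally have norm_r: "(\<Sum>\<alpha>\<in>monoms d. mcoeff \<alpha> * (r \<alpha>)\<^sup>2) \<le> real d * (real d - 1) / 2 * (s\<^sup>2)\<^sup>2" .
  have "(\<Sum>\<alpha>\<in>monoms d. Poly_Mapping.lookup P \<alpha> * r \<alpha>)
      = mpeval P y - c ^ d * mpeval P x - c ^ (d - 1) * s * mpderiv P x v"
    unfolding mpeval_hom[OF P] mpderiv_hom[OF P] sum_distrib_left sum_subtractf[symmetric]
    by (intro sum.cong) (auto simp: r_def algebra_simps)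
  then have "\<bar>mpeval P y - c ^ d * mpeval P x\<bar> = \<bar>\<Sum>\<alpha>\<in>monoms d. Poly_Mapping.lookup P \<alpha> * r \<alpha>\<bar>"
    by (simp add: crit)
  also have "\<dots> \<le> bombieri_norm d P * sqrt (\<Sum>\<alpha>\<in>monoms d. mcoeff \<alpha> * (r \<alpha>)\<^sup>2)"
    by (rule bombieri_Cauchy_Schwarz[OF P])
  also have "\<dots> \<le> bombieri_norm d P * sqrt (real d * (real d - 1) / 2 * (s\<^sup>2)\<^sup>2)"
    by (intro mult_left_mono real_sqrt_le_mono norm_r bombieri_norm_nonneg)
  also have "\<dots> = bombieri_norm d P * sqrt (real d * (real d - 1) / 2) * s\<^sup>2"
    by (simp only: real_sqrt_mult real_sqrt_abs abs_power2 mult.assoc)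
  finally show ?thesis
    by (simp add: y_def c_def s_def)
qed

text \<open>The bound on \<open>t\<close> makes the deviation less than \<open>D / 2\<close> and
  \<open>cos t ^ d\<close> more than \<open>1 / 2\<close>, so a zero would contradict
  \<open>D \<le> \<bar>mpeval P x\<bar>\<close>.\<close>

lemma mpeval_nonzero_near_critical_point:
  assumes P: "P \<in> hom_polys d" and d: "d > 1" and x: "norm x = 1" and v: "norm v = 1"
    and orth: "x \<bullet> v = 0" and crit: "mpderiv P x v = 0"
    and D: "0 < D" "D \<le> \<bar>mpeval P x\<bar>" "D \<le> bombieri_norm d P"
    and t: "real d ^ 2 * t\<^sup>2 * bombieri_norm d P < 2 * D"
  shows "mpeval P (cos t *\<^sub>R x + sin t *\<^sub>R v) \<noteq> 0"
proof
  assume zero: "mpeval P (cos t *\<^sub>R x + sin t *\<^sub>R v) = 0"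
  define N where "N = bombieri_norm d P"
  have N: "N > 0" "D \<le> N" using D by (auto simp: N_def)
  \<comment> \<open>Since \<open>D \<le> N\<close>, the bound on \<open>t\<close> becomes
    independent of \<open>P\<close>.\<close>
  have "(real d ^ 2 * t\<^sup>2) * N < 2 * N"
    using t N(2) unfolding N_def by linarith
  then have dt: "real d ^ 2 * t\<^sup>2 < 2"
    using N(1) by (simp only: mult_less_cancel_right_pos)
  have d2: "2 \<le> real d" using d by simp
  then have "2 * (real d * t\<^sup>2) \<le> real d * (real d * t\<^sup>2)"
    by (intro mult_right_mono) auto
  with dt have dt1: "real d * t\<^sup>2 < 1"
    by (simp add: power2_eq_square mult.assoc)
  have "1 * t\<^sup>2 \<le> real d * t\<^sup>2"
    using d2 by (intro mult_right_mono) auto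
  with dt1 have t1: "t\<^sup>2 < 1" by simp
  \<comment> \<open>Used through \<open>1 - cos t = 2 * (sin (t / 2))\<^sup>2\<close>.\<close>
  have "(sin (t / 2))\<^sup>2 \<le> (t / 2)\<^sup>2"
    using abs_sin_x_le_abs_x[of "t / 2"] by (simp only: abs_le_square_iff)
  then have cos: "1 - t\<^sup>2 / 2 \<le> cos t"
    using cos_double_sin[of "t / 2"] by (simp add: power_divide)
  have "1 / 2 < 1 + real d * (- (t\<^sup>2 / 2))"
    using dt1 by simp
  also have "\<dots> \<le> (1 + - (t\<^sup>2 / 2)) ^ d"
    using t1 by (intro Bernoulli_inequality) auto
  also have "\<dots> \<le> cos t ^ d"
    using cos t1 by (intro power_mono) auto
  finally have cd: "1 / 2 < cos t ^ d" .
  have "real d * (real d - 1) / 2 \<le> (real d ^ 2 / 4)\<^sup>2"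
  proof -
    \<comment> \<open>This product is 16 times the difference of the two sides; it vanishes at
      \<open>d = 2\<close>, where the bound is sharp.\<close>
    have "0 \<le> (real d - 2) * (real d * (real d + 2) - 4) * real d"
      using d2 by (intro mult_nonneg_nonneg) (auto intro: order_trans[OF _ mult_mono[of 2 _ 2]])
    then show ?thesis by (simp add: field_simps power2_eq_square)
  qed
  then have sq: "sqrt (real d * (real d - 1) / 2) \<le> real d ^ 2 / 4"
    by (intro real_le_lsqrt) auto
  have sin: "(sin t)\<^sup>2 \<le> t\<^sup>2"
    using abs_sin_x_le_abs_x[of t] by (simp add: abs_le_square_iff)
  have "cos t ^ d * \<bar>mpeval P x\<bar> = \<bar>mpeval P (cos t *\<^sub>R x + sin t *\<^sub>R v) - cos t ^ d * mpeval P x\<bar>"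
    using cd by (simp add: zero abs_mult)
  also have "\<dots> \<le> N * sqrt (real d * (real d - 1) / 2) * (sin t)\<^sup>2"
    unfolding N_def using d by (intro mpeval_near_critical_point assms) auto
  also have "\<dots> \<le> N * (real d ^ 2 / 4) * t\<^sup>2"
    using N sq sin by (intro mult_mono mult_left_mono) auto
  also have "\<dots> < 1 / 2 * D"
    using t by (simp add: N_def mult_ac)
  also have "\<dots> \<le> cos t ^ d * \<bar>mpeval P x\<bar>"
    using cd D by (intro mult_mono) auto
  finally show False by simp
qed

section \<open>Great circles and components of the nonzero set\<close>

lemma norm_great_circle:
  fixes x v :: "'a::real_inner"
  assumes "norm x = 1" "norm v = 1" "x \<bullet> v = 0"
  shows "norm (cos t *\<^sub>R x + sin t *\<^sub>R v) = 1"
  using assms sin_cos_squared_add2[of t]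
  by (simp add: norm_eq_1 inner_add_left inner_add_right inner_commute[of v x] power2_eq_square)

text \<open>The arc is connected, meets \<open>C\<close> in \<open>x\<close> at parameter 0 and
  avoids the zeros, so maximality of \<open>C\<close> absorbs it. \<open>I\<close> is left general
  to cover both a neighbourhood of 0 and a segment \<open>{0..t}\<close>.\<close>

lemma great_circle_arc_subset_component:
  fixes P :: "'n::finite mpoly"
  assumes C: "C \<in> components {x \<in> sphere 0 1. mpeval P x \<noteq> 0}" and x: "x \<in> C"
    and v: "norm v = 1" "x \<bullet> v = 0" and I: "connected I" "0 \<in> I"
    and nz: "\<And>t. t \<in> I \<Longrightarrow> mpeval P (cos t *\<^sub>R x + sin t *\<^sub>R v) \<noteq> 0" and t: "t \<in> I"
  shows "cos t *\<^sub>R x + sin t *\<^sub>R v \<in> C"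
proof -
  let ?g = "\<lambda>t. cos t *\<^sub>R x + sin t *\<^sub>R v"
  have x1: "norm x = 1"
    using in_components_subset[OF C] x by auto
  have "?g ` I \<subseteq> C"
  proof (rule components_maximal[OF C])
    show "connected (?g ` I)"
      by (intro connected_continuous_image continuous_intros I)
    show "?g ` I \<subseteq> {x \<in> sphere 0 1. mpeval P x \<noteq> 0}"
      using nz norm_great_circle[OF x1 v] by auto
    have "x = ?g 0" by simp
    then show "C \<inter> ?g ` I \<noteq> {}"
      using x I(2) by blast
  qed
  then show ?thesis using t by blast
qed

text \<open>A maximum exists on the compact closure of \<open>C\<close> and is nonzero. Adding a
  closure point keeps \<open>C\<close> connected, so by maximality the maximizer already lies in
  \<open>C\<close>.\<close>

lemma component_attains_max_abs:
  fixes P :: "'n::finite mpoly"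
  assumes C: "C \<in> components {x \<in> sphere 0 1. mpeval P x \<noteq> 0}"
  obtains x where "x \<in> C" "\<And>y. y \<in> C \<Longrightarrow> \<bar>mpeval P y\<bar> \<le> \<bar>mpeval P x\<bar>"
proof -
  have sub: "C \<subseteq> {x \<in> sphere 0 1. mpeval P x \<noteq> 0}" and ne: "C \<noteq> {}" and conn: "connected C"
    using C in_components_subset in_components_nonempty in_components_connected by blast+
  have clsub: "closure C \<subseteq> sphere 0 1"
    by (rule closure_minimal) (use sub in auto)
  have "compact (closure C)"
    using clsub by (meson bounded_sphere bounded_subset closed_closure compact_eq_bounded_closed)
  moreover have "closure C \<noteq> {}"
    using ne by simp
  moreover have "continuous_on (closure C) (\<lambda>y. \<bar>mpeval P y\<bar>)"
    by (intro continuous_intros continuous_on_mpeval)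
  ultimately obtain x where x: "x \<in> closure C" "\<And>y. y \<in> closure C \<Longrightarrow> \<bar>mpeval P y\<bar> \<le> \<bar>mpeval P x\<bar>"
    using continuous_attains_sup by meson
  have max: "\<bar>mpeval P y\<bar> \<le> \<bar>mpeval P x\<bar>" if "y \<in> C" for y
    using x(2) closure_subset that by blast
  obtain y where "y \<in> C" using ne by blast
  with max[of y] sub have nz: "mpeval P x \<noteq> 0" by auto
  have "insert x C \<subseteq> C"
  proof (rule components_maximal[OF C])
    show "connected (insert x C)"
      by (rule connected_intermediate_closure[OF conn]) (use x(1) closure_subset in auto)
    show "insert x C \<subseteq> {x \<in> sphere 0 1. mpeval P x \<noteq> 0}"
      using sub nz clsub x(1) by auto
    show "C \<inter> insert x C \<noteq> {}"
      using ne by blast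
  qed
  with max show ?thesis
    by (intro that[of x]) auto
qed

text \<open>Along the great circle through \<open>x\<close> in direction \<open>v\<close>, short
  arcs stay in \<open>C\<close>, so parameter 0 is a local maximum.\<close>

lemma mpderiv_eq_0_at_max_abs:
  fixes P :: "'n::finite mpoly"
  assumes C: "C \<in> components {x \<in> sphere 0 1. mpeval P x \<noteq> 0}" and x: "x \<in> C"
    and max: "\<And>y. y \<in> C \<Longrightarrow> \<bar>mpeval P y\<bar> \<le> \<bar>mpeval P x\<bar>"
    and v: "norm v = 1" "x \<bullet> v = 0"
  shows "mpderiv P x v = 0"
proof -
  let ?g = "\<lambda>t. cos t *\<^sub>R x + sin t *\<^sub>R v"
  define f where "f = (\<lambda>t. mpeval P (?g t))"
  have nz: "f 0 \<noteq> 0"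
    using in_components_subset[OF C] x by (auto simp: f_def)
  have "(?g has_derivative (\<lambda>t. t *\<^sub>R v)) (at 0)"
    by (auto intro!: derivative_eq_intros simp: fun_eq_iff)
  from has_derivative_compose[OF this has_derivative_mpeval[of P "?g 0"]]
  have "(f has_derivative (\<lambda>t. mpderiv P x (t *\<^sub>R v))) (at 0)"
    by (simp add: f_def)
  moreover have "mpderiv P x (t *\<^sub>R v) = mpderiv P x v * t" for t
    using linear_cmul[OF has_derivative_linear[OF has_derivative_mpeval[of P x]], of t v] by simp
  ultimately have deriv: "(f has_real_derivative mpderiv P x v) (at 0)"
    by (simp add: has_field_derivative_def)
  \<comment> \<open>The square replaces the absolute value to have a derivative;
    \<open>f 0 \<noteq> 0\<close> then lets the factor \<open>2 * f 0\<close> be cancelled.\<close>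
  then have sq: "((\<lambda>t. (f t)\<^sup>2) has_real_derivative 2 * f 0 * mpderiv P x v) (at 0)"
    by (auto intro!: derivative_eq_intros)
  have "isCont f 0"
    using deriv DERIV_isCont by blast
  then obtain e where e: "e > 0" "\<And>t. dist 0 t < e \<Longrightarrow> f t \<noteq> 0"
    using continuous_at_avoid[of 0 f 0] nz by auto
  have "(f t)\<^sup>2 \<le> (f 0)\<^sup>2" if "\<bar>0 - t\<bar> < e" for t
  proof -
    have "?g t \<in> C"
    proof (rule great_circle_arc_subset_component[OF C x v, where I = "ball 0 e"])
      show "mpeval P (?g t) \<noteq> 0" if "t \<in> ball 0 e" for t
        using e(2)[of t] that by (simp add: f_def)
    qed (use e that in auto)
    from max[OF this] show ?thesis
      by (simp add: f_def abs_le_square_iff)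
  qed
  with DERIV_local_max[OF sq e(1)] nz show ?thesis by auto
qed

section \<open>Caps around the maxima of the absolute value\<close>

theorem corollary10p2:
  fixes P :: "'n::finite mpoly" and d :: nat
  assumes "CARD('n) > 1" and "d > 1"
    and "P \<in> hom_polys d"
    and "dist_discriminant d P \<noteq> 0"
  shows "\<forall>C \<in> components {x \<in> sphere 0 1. mpeval P x \<noteq> 0}.
           \<exists>x \<in> sphere 0 1.
             open_cap x (1 / real d * sqrt (2 * dist_discriminant d P / bombieri_norm d P)) \<subseteq> C"
proof
  fix C assume C: "C \<in> components {x \<in> sphere 0 1. mpeval P x \<noteq> 0}"
  define D N a where "D = dist_discriminant d P" and "N = bombieri_norm d P"
    and "a = 1 / real d * sqrt (2 * D / N)"
  obtain x where x: "x \<in> C" and max: "\<And>y. y \<in> C \<Longrightarrow> \<bar>mpeval P y\<bar> \<le> \<bar>mpeval P x\<bar>"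
    by (rule component_attains_max_abs[OF C]) blast
  have x1: "norm x = 1"
    using in_components_subset[OF C] x by auto
  have crit: "mpderiv P x v = 0" if "norm v = 1" "x \<bullet> v = 0" for v
    by (rule mpderiv_eq_0_at_max_abs[OF C x _ that]) (rule max)
  have D: "D > 0" "D \<le> N" "D \<le> \<bar>mpeval P x\<bar>"
  proof -
    show "D > 0"
      using assms(4) dist_discriminant_nonneg[of d P] by (simp add: D_def)
    \<comment> \<open>The zero polynomial is a competitor in the infimum.\<close>
    show "D \<le> N"
      using dist_discriminant_le[OF zero_in_real_discriminant, of d P] by (simp add: D_def N_def)
    show "D \<le> \<bar>mpeval P x\<bar>"
      unfolding D_def by (rule dist_discriminant_le_critical_value[OF assms(3) x1 crit])
  qed
  \<comment> \<open>The radius \<open>a\<close> solves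
    \<open>real d ^ 2 * a\<^sup>2 * N = 2 * D\<close>.\<close>
  have small: "real d ^ 2 * t\<^sup>2 * N < 2 * D" if "0 \<le> t" "t < a" for t
  proof -
    have "t\<^sup>2 < a\<^sup>2"
      using that by (intro power_strict_mono) auto
    then show ?thesis
      using assms(2) D by (simp add: a_def power_mult_distrib power_divide field_simps)
  qed
  \<comment> \<open>Keeps angles in the cap below \<open>pi\<close>, so that
    \<open>sin t > 0\<close> off the centre.\<close>
  have "a \<le> 1"
  proof -
    have "2\<^sup>2 \<le> (real d)\<^sup>2"
      using assms(2) by (intro power_mono) auto
    then have "2 * D \<le> (real d)\<^sup>2 * N"
      using D by (intro mult_mono) auto
    then have "sqrt (2 * D / N) \<le> real d"
      using D by (intro real_le_lsqrt) (auto simp: divide_le_eq)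
    then show ?thesis
      using assms(2) by (simp add: a_def)
  qed
  have "open_cap x a \<subseteq> C"
  proof
    fix y assume "y \<in> open_cap x a"
    then have y: "norm y = 1" and ya: "arccos (x \<bullet> y) < a"
      by (auto simp: open_cap_def)
    define t where "t = arccos (x \<bullet> y)"
    have xy: "\<bar>x \<bullet> y\<bar> \<le> 1"
      using Cauchy_Schwarz_ineq2[of x y] x1 y by simp
    then have t: "0 \<le> t" "t < a" "cos t = x \<bullet> y"
      using ya arccos_lbound[of "x \<bullet> y"] by (auto simp: t_def cos_arccos_abs)
    show "y \<in> C"
    \<comment> \<open>At angle 0 no direction \<open>v\<close> is determined; the equality case of
      Cauchy-Schwarz gives \<open>y = x\<close>.\<close>
    proof (cases "t = 0")
      case True
      then have "x \<bullet> y = 1" using t by simp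
      then have "x = y"
        using norm_cauchy_schwarz_eq[of x y] x1 y by simp
      then show ?thesis using x by simp
    next
      case False
      have "sin t > 0"
        using False t \<open>a \<le> 1\<close> pi_gt3 by (intro sin_gt_zero) auto
      \<comment> \<open>The unit tangent vector at \<open>x\<close> pointing to \<open>y\<close>, so
        that \<open>y = cos t *\<^sub>R x + sin t *\<^sub>R v\<close>.\<close>
      define v where "v = (y - cos t *\<^sub>R x) /\<^sub>R sin t"
      have inner: "x \<bullet> x = 1" "y \<bullet> y = 1" "y \<bullet> x = cos t" "x \<bullet> y = cos t"
        using x1 y t by (auto simp: norm_eq_1 inner_commute)
      have "(y - cos t *\<^sub>R x) \<bullet> (y - cos t *\<^sub>R x) = (sin t)\<^sup>2"
        using sin_squared_eq[of t]
        by (simp add: inner_diff_left inner_diff_right inner power2_eq_square)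
      then have "norm (y - cos t *\<^sub>R x) = sin t"
        using \<open>sin t > 0\<close> by (simp only: norm_eq_sqrt_inner) simp
      then have v: "norm v = 1" "x \<bullet> v = 0"
        using \<open>sin t > 0\<close> by (auto simp: v_def inner_diff_right inner)
      have "cos t *\<^sub>R x + sin t *\<^sub>R v \<in> C"
      \<comment> \<open>Every \<open>s\<close> in \<open>{0..t}\<close> is also less than
        \<open>a\<close>, so \<open>small\<close> excludes zeros along the whole arc from
        \<open>x\<close> to \<open>y\<close>.\<close>
      proof (rule great_circle_arc_subset_component[OF C x v, where I = "{0..t}"])
        show "mpeval P (cos s *\<^sub>R x + sin s *\<^sub>R v) \<noteq> 0" if "s \<in> {0..t}" for s
          using that t small[of s] D assms(2)
          by (intro mpeval_nonzero_near_critical_point[OF assms(3) _ x1 v crit[OF v], of D])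
            (auto simp: N_def)
      qed (use t in auto)
      then show ?thesis
        using \<open>sin t > 0\<close> by (simp add: v_def)
    qed
  qed
  then show "\<exists>x \<in> sphere 0 1.
      open_cap x (1 / real d * sqrt (2 * dist_discriminant d P / bombieri_norm d P)) \<subseteq> C"
    using x1 by (auto simp: a_def D_def N_def)
qed

end
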